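(* Let $\lambda$ be an infinite cardinal. Each chain of idempotents in the monoid $\mathscr{I}^{\mathrm{cf}}_\lambda$ of injective partial cofinite selfmaps of $\lambda$ is contained in a bicyclic subsemigroup of $\mathscr{I}^{\mathrm{cf}}_\lambda$.
   Context: The infinite cardinal $\lambda$ is identified with a set of cardinality $\lambda$. $\mathscr{I}^{\mathrm{cf}}_\lambda$ is the set of all injective partial maps $\alpha\colon\lambda\rightharpoonup\lambda$ such that $\lambda\setminus\operatorname{dom}\alpha$ and $\lambda\setminus\operatorname{ran}\alpha$ are both finite. Maps are written on the right and composed left to right: $x(\alpha\beta)=(x\alpha)\beta$ for $x\in\operatorname{dom}(\alpha\beta)=\{y\in\operatorname{dom}\alpha\mid y\alpha\in\operatorname{dom}\beta\}$. With this operation $\mathscr{I}^{\mathrm{cf}}_\lambda$ is an inverse monoid. The set of idempotents carries the natural partial order $e\leqslant f$ iff $ef=fe=e$; a chain of idempotents is a subset linearly ordered by $\leqslant$. The bicyclic semigroup $\mathscr{C}(p,q)$ is the semigroup with identity $1$ generated by elements $p$ and $q$ subject only to the condition $pq=1$. A subsemigroup $S$ of a semigroup $T$ is a bicyclic subsemigroup of $T$ if $S$ is isomorphic to $\mathscr{C}(p,q)$. (The identity of a bicyclic subsemigroup is not required to be the identity of $T$.) *)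

theory Defs
  imports "HOL-Algebra.Group"
begin

definition idempotents :: "('a, 'm) monoid_scheme \<Rightarrow> 'a set" where
  "idempotents G = {e \<in> carrier G. e \<otimes>\<^bsub>G\<^esub> e = e}"

definition natural_order :: "('a, 'm) monoid_scheme \<Rightarrow> 'a rel" where
  "natural_order G =
     {(e, f). e \<in> idempotents G \<and> f \<in> idempotents G \<and> e \<otimes>\<^bsub>G\<^esub> f = e \<and> f \<otimes>\<^bsub>G\<^esub> e = e}"

definition idempotent_chain :: "('a, 'm) monoid_scheme \<Rightarrow> 'a set \<Rightarrow> bool" where
  "idempotent_chain G C \<longleftrightarrow>
     C \<subseteq> idempotents G \<and> linear_order_on C (Restr (natural_order G) C)"

definition subsemigroup :: "('a, 'm) monoid_scheme \<Rightarrow> 'a set \<Rightarrow> bool" where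
  "subsemigroup G S \<longleftrightarrow>
     S \<subseteq> carrier G \<and> (\<forall>x\<in>S. \<forall>y\<in>S. x \<otimes>\<^bsub>G\<^esub> y \<in> S)"


text \<open>The bicyclic semigroup is the free monoid on two letters modulo the least congruence
  that identifies the word \<open>pq\<close> with the empty word.\<close>

datatype letter = P | Q

inductive_set bicyclic_congruence :: "letter list rel" where
  relator: "([P, Q], []) \<in> bicyclic_congruence"
| refl: "(u, u) \<in> bicyclic_congruence"
| sym: "(u, v) \<in> bicyclic_congruence \<Longrightarrow> (v, u) \<in> bicyclic_congruence"
| trans: "(u, v) \<in> bicyclic_congruence \<Longrightarrow> (v, w) \<in> bicyclic_congruence
    \<Longrightarrow> (u, w) \<in> bicyclic_congruence"
| append: "(u, v) \<in> bicyclic_congruence \<Longrightarrow> (x, y) \<in> bicyclic_congruence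
    \<Longrightarrow> (u @ x, v @ y) \<in> bicyclic_congruence"

definition word_class :: "letter list \<Rightarrow> letter list set" where
  "word_class w = bicyclic_congruence `` {w}"

definition bicyclic :: "letter list set monoid" where
  "bicyclic =
     \<lparr>carrier = UNIV // bicyclic_congruence,
      mult = (\<lambda>X Y. \<Union>u\<in>X. \<Union>v\<in>Y. word_class (u @ v)),
      one = word_class []\<rparr>"

lemma equiv_bicyclic_congruence: "equiv UNIV bicyclic_congruence"
proof (rule equivI)
  show "refl bicyclic_congruence"
    by (rule refl_onI) (rule bicyclic_congruence.refl)
  show "sym_on UNIV bicyclic_congruence"
    by (rule symI) (rule bicyclic_congruence.sym)
  show "trans bicyclic_congruence"
    by (rule transI) (rule bicyclic_congruence.trans)
qed simp

lemma carrier_bicyclic: "carrier bicyclic = range word_class"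
  by (auto simp: bicyclic_def word_class_def quotient_def)

lemma word_class_eq_iff: "word_class u = word_class v \<longleftrightarrow> (u, v) \<in> bicyclic_congruence"
  unfolding word_class_def
  using eq_equiv_class_iff[OF equiv_bicyclic_congruence] by auto

lemma mult_word_class: "word_class u \<otimes>\<^bsub>bicyclic\<^esub> word_class v = word_class (u @ v)"
proof -
  have "word_class (u' @ v') = word_class (u @ v)"
    if "u' \<in> word_class u" "v' \<in> word_class v" for u' v'
    unfolding word_class_eq_iff
    using that unfolding word_class_def Image_singleton_iff
    by (rule bicyclic_congruence.sym[OF bicyclic_congruence.append])
  moreover have "u \<in> word_class u" "v \<in> word_class v"
    by (simp_all add: word_class_def bicyclic_congruence.refl)
  ultimately have "(\<Union>u'\<in>word_class u. \<Union>v'\<in>word_class v. word_class (u' @ v')) = word_class (u @ v)"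
    by blast
  then show ?thesis
    by (simp add: bicyclic_def)
qed

lemma one_bicyclic: "\<one>\<^bsub>bicyclic\<^esub> = word_class []"
  by (simp add: bicyclic_def)

lemma monoid_bicyclic: "monoid bicyclic"
  by (rule monoidI) (auto simp: carrier_bicyclic one_bicyclic mult_word_class)

lemma bicyclic_relation: "word_class [P] \<otimes>\<^bsub>bicyclic\<^esub> word_class [Q] = \<one>\<^bsub>bicyclic\<^esub>"
  using bicyclic_congruence.relator
  by (simp add: mult_word_class one_bicyclic word_class_eq_iff)


text \<open>The unit field of the record \<open>G\<lparr>carrier := S\<rparr>\<close> is still that of \<open>G\<close> and need not lie in \<open>S\<close>;
  \<open>\<cong>\<close> only involves carriers and multiplications, so it is semigroup isomorphism here.\<close>

definition bicyclic_subsemigroup :: "('a, 'm) monoid_scheme \<Rightarrow> 'a set \<Rightarrow> bool" where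
  "bicyclic_subsemigroup G S \<longleftrightarrow> subsemigroup G S \<and> G\<lparr>carrier := S\<rparr> \<cong> bicyclic"


text \<open>Maps are written on the right, so the product of \<open>\<alpha>\<close> and \<open>\<beta>\<close> applies \<open>\<alpha>\<close> first.\<close>

definition cofinite_partial_injections :: "'a set \<Rightarrow> ('a \<rightharpoonup> 'a) monoid" where
  "cofinite_partial_injections L =
     \<lparr>carrier = {\<alpha>. dom \<alpha> \<subseteq> L \<and> ran \<alpha> \<subseteq> L \<and> inj_on \<alpha> (dom \<alpha>)
                   \<and> finite (L - dom \<alpha>) \<and> finite (L - ran \<alpha>)},
      mult = (\<lambda>\<alpha> \<beta>. \<beta> \<circ>\<^sub>m \<alpha>),
      one = Some |` L\<rparr>"

lemma monoid_cofinite_partial_injections: "monoid (cofinite_partial_injections L)"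
proof (rule monoidI)
  fix \<alpha> \<beta>
  assume "\<alpha> \<in> carrier (cofinite_partial_injections L)"
    and "\<beta> \<in> carrier (cofinite_partial_injections L)"
  then have a: "dom \<alpha> \<subseteq> L" "ran \<alpha> \<subseteq> L" "inj_on \<alpha> (dom \<alpha>)"
      "finite (L - dom \<alpha>)" "finite (L - ran \<alpha>)"
    and b: "dom \<beta> \<subseteq> L" "ran \<beta> \<subseteq> L" "inj_on \<beta> (dom \<beta>)"
      "finite (L - dom \<beta>)" "finite (L - ran \<beta>)"
    by (simp_all add: cofinite_partial_injections_def)
  have eq: "(\<beta> \<circ>\<^sub>m \<alpha>) x = Some z \<longleftrightarrow> (\<exists>y. \<alpha> x = Some y \<and> \<beta> y = Some z)" for x z
    by (simp add: map_comp_Some_iff)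
  have "dom (\<beta> \<circ>\<^sub>m \<alpha>) \<subseteq> L" "ran (\<beta> \<circ>\<^sub>m \<alpha>) \<subseteq> L"
    using a b by (auto simp: dom_def ran_def map_comp_Some_iff)
  moreover have "inj_on (\<beta> \<circ>\<^sub>m \<alpha>) (dom (\<beta> \<circ>\<^sub>m \<alpha>))"
  proof (rule inj_onI)
    fix x x'
    assume "x \<in> dom (\<beta> \<circ>\<^sub>m \<alpha>)" and same: "(\<beta> \<circ>\<^sub>m \<alpha>) x = (\<beta> \<circ>\<^sub>m \<alpha>) x'"
    then obtain y z where y: "\<alpha> x = Some y" "\<beta> y = Some z"
      unfolding dom_def using eq by blast
    with same obtain y' where y': "\<alpha> x' = Some y'" "\<beta> y' = Some z"
      by (metis eq)
    have "y = y'"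
      using b(3) y(2) y'(2) by (metis domI inj_onD)
    then show "x = x'"
      using a(3) y(1) y'(1) by (metis domI inj_onD)
  qed
  moreover have "finite (L - dom (\<beta> \<circ>\<^sub>m \<alpha>))"
  proof (rule finite_subset)
    let ?B = "{x \<in> dom \<alpha>. \<alpha> x \<in> Some ` (L - dom \<beta>)}"
    show "L - dom (\<beta> \<circ>\<^sub>m \<alpha>) \<subseteq> (L - dom \<alpha>) \<union> ?B"
    proof
      fix x assume x: "x \<in> L - dom (\<beta> \<circ>\<^sub>m \<alpha>)"
      show "x \<in> (L - dom \<alpha>) \<union> ?B"
      proof (cases "\<alpha> x")
        case None
        then show ?thesis using x by auto
      next
        case (Some y)
        then have "y \<in> L" using a(2) by (auto simp: ran_def)
        moreover have "y \<notin> dom \<beta>" using x Some by (auto simp: dom_def)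
        ultimately show ?thesis using Some by auto
      qed
    qed
    have "inj_on \<alpha> ?B"
      using a(3) by (rule inj_on_subset) auto
    moreover have "finite (\<alpha> ` ?B)"
      by (rule finite_subset[of _ "Some ` (L - dom \<beta>)"]) (use b(4) in auto)
    ultimately show "finite ((L - dom \<alpha>) \<union> ?B)"
      using a(4) finite_imageD by blast
  qed
  moreover have "finite (L - ran (\<beta> \<circ>\<^sub>m \<alpha>))"
  proof (rule finite_subset)
    show "L - ran (\<beta> \<circ>\<^sub>m \<alpha>) \<subseteq> (L - ran \<beta>) \<union> (\<lambda>y. the (\<beta> y)) ` (L - ran \<alpha>)"
    proof
      fix z assume z: "z \<in> L - ran (\<beta> \<circ>\<^sub>m \<alpha>)"
      show "z \<in> (L - ran \<beta>) \<union> (\<lambda>y. the (\<beta> y)) ` (L - ran \<alpha>)"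
      proof (cases "z \<in> ran \<beta>")
        case True
        then obtain y where y: "\<beta> y = Some z" by (auto simp: ran_def)
        then have "y \<in> L" using b(1) by auto
        moreover have "y \<notin> ran \<alpha>"
          using z y eq unfolding ran_def by blast
        ultimately have "y \<in> L - ran \<alpha>" by blast
        then show ?thesis using y by force
      qed (use z in blast)
    qed
    show "finite ((L - ran \<beta>) \<union> (\<lambda>y. the (\<beta> y)) ` (L - ran \<alpha>))"
      using a(5) b(5) by simp
  qed
  ultimately show "\<alpha> \<otimes>\<^bsub>cofinite_partial_injections L\<^esub> \<beta> \<in> carrier (cofinite_partial_injections L)"
    by (simp add: cofinite_partial_injections_def)
next
  have "dom (Some |` L) = L" "ran (Some |` L) = L" "inj_on (Some |` L) L"
    by (auto simp: dom_def ran_def restrict_map_def inj_on_def)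
  then show "\<one>\<^bsub>cofinite_partial_injections L\<^esub> \<in> carrier (cofinite_partial_injections L)"
    by (simp add: cofinite_partial_injections_def)
next
  fix \<alpha> assume "\<alpha> \<in> carrier (cofinite_partial_injections L)"
  then have a: "dom \<alpha> \<subseteq> L" "ran \<alpha> \<subseteq> L"
    by (simp_all add: cofinite_partial_injections_def)
  have "(\<alpha> \<circ>\<^sub>m Some |` L) x = \<alpha> x" for x
    using a(1) by (cases "\<alpha> x") (auto simp: map_comp_def restrict_map_def)
  then show "\<one>\<^bsub>cofinite_partial_injections L\<^esub> \<otimes>\<^bsub>cofinite_partial_injections L\<^esub> \<alpha> = \<alpha>"
    by (simp add: cofinite_partial_injections_def fun_eq_iff)
  have "(Some |` L \<circ>\<^sub>m \<alpha>) x = \<alpha> x" for x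
    using a(2) by (cases "\<alpha> x") (auto simp: map_comp_def restrict_map_def ran_def)
  then show "\<alpha> \<otimes>\<^bsub>cofinite_partial_injections L\<^esub> \<one>\<^bsub>cofinite_partial_injections L\<^esub> = \<alpha>"
    by (simp add: cofinite_partial_injections_def fun_eq_iff)
qed (simp add: cofinite_partial_injections_def map_comp_def fun_eq_iff split: option.split)

end

theory Submission
  imports Defs
begin

text \<open>
  An idempotent of the monoid is the identity map of a cofinite subset of \<open>L\<close>, so a chain of
  idempotents is the same thing as a family of finite sets (the complements of the domains) that
  is linearly ordered by inclusion. Such a family has at most one member of each cardinality, and
  the points of its union can be listed, smaller sets first, by an injective sequence \<open>s 0, s 1, \<dots>\<close> in \<open>L\<close>
  so that each member is an initial segment \<open>s ` {..<n}\<close> (\<open>chain_of_initial_segments\<close>); because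
  \<open>L\<close> is infinite, the sequence can be continued when the family is exhausted.

  Let \<open>p\<close> be the total injection of \<open>L\<close> that moves \<open>s k\<close> to \<open>s (k + 1)\<close> and fixes all other
  points, and let \<open>q\<close> be its partial inverse. Then \<open>pq = 1\<close> and \<open>qp \<noteq> 1\<close>. In any monoid
  two such elements generate a bicyclic subsemigroup
  (\<open>bicyclic_subsemigroup_of_one_sided_inverse\<close>), and here it contains the idempotents
  \<open>q\<^sup>n p\<^sup>n\<close>, which are the identity maps of the sets \<open>L - s ` {..<n}\<close>
  (\<open>shift_power_idempotent\<close>). All members of the chain are among them.
\<close>

section \<open>Bicyclic subsemigroups from one-sided inverses\<close>

primrec letter_value :: "('a, 'm) monoid_scheme \<Rightarrow> 'a \<Rightarrow> 'a \<Rightarrow> letter \<Rightarrow> 'a" where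
  "letter_value G p q P = p"
| "letter_value G p q Q = q"

primrec word_value :: "('a, 'm) monoid_scheme \<Rightarrow> 'a \<Rightarrow> 'a \<Rightarrow> letter list \<Rightarrow> 'a" where
  "word_value G p q [] = \<one>\<^bsub>G\<^esub>"
| "word_value G p q (x # w) = letter_value G p q x \<otimes>\<^bsub>G\<^esub> word_value G p q w"

text \<open>Every occurrence of \<open>PQ\<close> can be cancelled, so each class has a representative in which all
  letters \<open>Q\<close> precede all letters \<open>P\<close>.\<close>

lemma bicyclic_normal_form:
  "\<exists>m n. (w, replicate m Q @ replicate n P) \<in> bicyclic_congruence"
proof (induction w)
  case Nil
  have "([], replicate 0 Q @ replicate 0 P) \<in> bicyclic_congruence"
    by (simp add: bicyclic_congruence.refl)
  then show ?case by blast
next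
  case (Cons x w)
  then obtain m n where "(w, replicate m Q @ replicate n P) \<in> bicyclic_congruence"
    by blast
  from bicyclic_congruence.append[OF bicyclic_congruence.refl[of "[x]"] this]
  have step: "(x # w, x # replicate m Q @ replicate n P) \<in> bicyclic_congruence"
    by simp
  show ?case
  proof (cases x)
    case Q
    then have "(x # w, replicate (Suc m) Q @ replicate n P) \<in> bicyclic_congruence"
      using step by simp
    then show ?thesis by blast
  next
    case P
    show ?thesis
    proof (cases m)
      case 0
      then have "(x # w, replicate 0 Q @ replicate (Suc n) P) \<in> bicyclic_congruence"
        using step P by simp
      then show ?thesis by blast
    next
      case (Suc k)
      have "([P, Q] @ replicate k Q @ replicate n P, [] @ replicate k Q @ replicate n P)
          \<in> bicyclic_congruence"
        by (intro bicyclic_congruence.append bicyclic_congruence.relator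
            bicyclic_congruence.refl)
      then have "(x # w, replicate k Q @ replicate n P) \<in> bicyclic_congruence"
        using step P Suc by (auto intro: bicyclic_congruence.trans)
      then show ?thesis by blast
    qed
  qed
qed

context monoid
begin

lemma word_value_closed [simp]:
  assumes "p \<in> carrier G" "q \<in> carrier G"
  shows "word_value G p q w \<in> carrier G"
proof (induction w)
  case (Cons x w)
  then show ?case using assms by (cases x) auto
qed simp

lemma word_value_append:
  assumes "p \<in> carrier G" "q \<in> carrier G"
  shows "word_value G p q (u @ v) = word_value G p q u \<otimes> word_value G p q v"
proof (induction u)
  case (Cons x u)
  then show ?case using assms by (cases x) (auto simp: m_assoc)
qed (use assms in simp)

lemma power_commutes_self:
  assumes "x \<in> carrier G"
  shows "x \<otimes> x [^] (n::nat) = x [^] n \<otimes> x"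
  using nat_pow_comm[of x 1 n] assms by simp

lemma word_value_normal_form:
  assumes "p \<in> carrier G" "q \<in> carrier G"
  shows "word_value G p q (replicate m Q @ replicate n P) = q [^] m \<otimes> p [^] n"
proof -
  have "word_value G p q (replicate n P) = p [^] n" for n
    by (induction n) (simp_all add: power_commutes_self assms(1))
  moreover have "word_value G p q (replicate m Q) = q [^] m" for m
    by (induction m) (simp_all add: power_commutes_self assms(2))
  ultimately show ?thesis by (simp add: word_value_append[OF assms])
qed

lemma word_value_respects_congruence:
  assumes "p \<in> carrier G" "q \<in> carrier G" "p \<otimes> q = \<one>"
    and "(u, v) \<in> bicyclic_congruence"
  shows "word_value G p q u = word_value G p q v"
  using assms(4)
  by induction (use assms(1-3) in \<open>simp_all add: word_value_append\<close>)

lemma power_one_sided_inverse: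
  assumes "p \<in> carrier G" "q \<in> carrier G" "p \<otimes> q = \<one>"
  shows "p [^] (n::nat) \<otimes> q [^] n = \<one>"
proof (induction n)
  case (Suc n)
  have "p [^] Suc n \<otimes> q [^] Suc n = p [^] n \<otimes> (p \<otimes> q) \<otimes> q [^] n"
    unfolding nat_pow_Suc2[OF assms(2)] using assms(1,2) by (simp add: m_assoc)
  then show ?case using assms Suc by simp
qed simp

text \<open>Cancelling common powers in an equality of two different normal forms leaves an equation that
  makes \<open>p\<close> or \<open>q\<close> invertible, and then \<open>q\<close> would be the two-sided inverse of \<open>p\<close>.\<close>

lemma one_sided_inverse_normal_form_unique:
  assumes p: "p \<in> carrier G" and q: "q \<in> carrier G"
    and pq: "p \<otimes> q = \<one>" and qp: "q \<otimes> p \<noteq> \<one>"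
    and eq: "q [^] (m::nat) \<otimes> p [^] (n::nat) = q [^] (i::nat) \<otimes> p [^] (j::nat)"
  shows "m = i \<and> n = j"
proof -
  have no_right: "q \<otimes> x \<noteq> \<one>" if x: "x \<in> carrier G" for x
  proof
    assume "q \<otimes> x = \<one>"
    moreover from this have "x = p"
      using m_assoc[OF p q x] p q x pq by simp
    ultimately show False using qp by simp
  qed
  have no_left: "x \<otimes> p \<noteq> \<one>" if x: "x \<in> carrier G" for x
  proof
    assume "x \<otimes> p = \<one>"
    moreover from this have "x = q"
      using m_assoc[OF x p q] p q x pq by simp
    ultimately show False using qp by simp
  qed
  have inverse: "p [^] k \<otimes> q [^] k = \<one>" for k :: nat
    using power_one_sided_inverse[OF p q pq] .
  \<comment> \<open>Multiplying by \<open>p\<^sup>m\<close> on the left and by \<open>q\<^sup>n\<close> on the right turns one side into \<open>1\<close>,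
    while the other side keeps the factor \<open>q\<close> on the left if \<open>m < i\<close>.\<close>
  have no_less: "\<not> m < i"
    if eq: "q [^] m \<otimes> p [^] n = q [^] i \<otimes> p [^] j" for m n i j :: nat
  proof
    assume "m < i"
    then obtain d where i: "i = m + Suc d"
      using less_imp_Suc_add by force
    have "\<one> = (p [^] m \<otimes> q [^] m) \<otimes> (p [^] n \<otimes> q [^] n)"
      by (simp add: inverse)
    also have "\<dots> = p [^] m \<otimes> (q [^] m \<otimes> p [^] n) \<otimes> q [^] n"
      using p q by (simp add: m_assoc)
    also have "\<dots> = (p [^] m \<otimes> q [^] m) \<otimes> (q [^] Suc d \<otimes> (p [^] j \<otimes> q [^] n))"
      using p q by (simp add: eq i m_assoc nat_pow_mult[symmetric] del: nat_pow_Suc)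
    also have "\<dots> = q \<otimes> (q [^] d \<otimes> (p [^] j \<otimes> q [^] n))"
      unfolding nat_pow_Suc2[OF q] using p q by (simp add: inverse m_assoc)
    finally show False using no_right p q by (metis m_closed nat_pow_closed)
  qed
  then have m: "m = i" using eq by (metis linorder_neqE_nat)
  have powers: "p [^] n = p [^] j"
  proof -
    have "p [^] n = p [^] m \<otimes> (q [^] m \<otimes> p [^] n)"
      using p q by (simp add: m_assoc[symmetric] inverse)
    also have "\<dots> = p [^] m \<otimes> (q [^] m \<otimes> p [^] j)"
      using eq m by simp
    also have "\<dots> = p [^] j"
      using p q by (simp add: m_assoc[symmetric] inverse)
    finally show ?thesis .
  qed
  have no_less': "\<not> n < j" if eq: "p [^] n = p [^] j" for n j :: nat
  proof
    assume "n < j"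
    then obtain d where j: "j = Suc d + n"
      using less_imp_Suc_add by (metis add.commute add_Suc_right)
    have "\<one> = p [^] j \<otimes> q [^] n"
      using inverse[of n] eq by simp
    also have "\<dots> = p [^] Suc d \<otimes> (p [^] n \<otimes> q [^] n)"
      using p q by (simp add: j m_assoc nat_pow_mult[symmetric] del: nat_pow_Suc add_Suc)
    also have "\<dots> = p [^] d \<otimes> p"
      using p by (simp add: inverse)
    finally show False using no_left p by (metis nat_pow_closed)
  qed
  then have "n = j" using powers by (metis linorder_neqE_nat)
  with m show ?thesis by simp
qed

text \<open>The isomorphism sends an element to the set of all words that evaluate to it. Uniqueness of
  normal forms in \<open>G\<close> says that this set is a single congruence class.\<close>

theorem bicyclic_subsemigroup_of_one_sided_inverse:
  assumes p: "p \<in> carrier G" and q: "q \<in> carrier G"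
    and pq: "p \<otimes> q = \<one>" and qp: "q \<otimes> p \<noteq> \<one>"
  shows "bicyclic_subsemigroup G (range (word_value G p q))"
proof -
  let ?v = "word_value G p q"
  let ?h = "\<lambda>x. {w. ?v w = x}"
  have congruent_iff: "?v u = ?v v \<longleftrightarrow> (u, v) \<in> bicyclic_congruence" for u v
  proof
    assume eq: "?v u = ?v v"
    obtain m n where u: "(u, replicate m Q @ replicate n P) \<in> bicyclic_congruence"
      using bicyclic_normal_form by blast
    obtain i j where v: "(v, replicate i Q @ replicate j P) \<in> bicyclic_congruence"
      using bicyclic_normal_form by blast
    have "q [^] m \<otimes> p [^] n = q [^] i \<otimes> p [^] j"
      using word_value_respects_congruence[OF p q pq u]
        word_value_respects_congruence[OF p q pq v] eq
      by (simp add: word_value_normal_form[OF p q])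
    then have "m = i \<and> n = j"
      by (rule one_sided_inverse_normal_form_unique[OF p q pq qp])
    then show "(u, v) \<in> bicyclic_congruence"
      using u v by (blast intro: bicyclic_congruence.sym bicyclic_congruence.trans)
  qed (rule word_value_respects_congruence[OF p q pq])
  have h: "?h (?v w) = word_class w" for w
    by (auto simp: word_class_def congruent_iff intro: bicyclic_congruence.sym)
  have "?h \<in> hom (G\<lparr>carrier := range ?v\<rparr>) bicyclic"
  proof (rule homI)
    fix x assume "x \<in> carrier (G\<lparr>carrier := range ?v\<rparr>)"
    then show "?h x \<in> carrier bicyclic"
      using h by (auto simp: carrier_bicyclic)
  next
    fix x y
    assume "x \<in> carrier (G\<lparr>carrier := range ?v\<rparr>)" "y \<in> carrier (G\<lparr>carrier := range ?v\<rparr>)"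
    then obtain u w where xy: "x = ?v u" "y = ?v w" by auto
    have "?h (x \<otimes> y) = word_class (u @ w)"
      using h[of "u @ w"] by (simp add: xy word_value_append[OF p q])
    also have "\<dots> = ?h x \<otimes>\<^bsub>bicyclic\<^esub> ?h y"
      unfolding xy h by (simp add: mult_word_class)
    finally show "?h (x \<otimes>\<^bsub>G\<lparr>carrier := range ?v\<rparr>\<^esub> y) = ?h x \<otimes>\<^bsub>bicyclic\<^esub> ?h y"
      by simp
  qed
  moreover have "bij_betw ?h (range ?v) (carrier bicyclic)"
    unfolding bij_betw_def
  proof
    show "inj_on ?h (range ?v)"
      by (auto simp: inj_on_def)
    show "?h ` range ?v = carrier bicyclic"
      using h by (simp add: carrier_bicyclic image_image)
  qed
  ultimately have "G\<lparr>carrier := range ?v\<rparr> \<cong> bicyclic"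
    by (auto simp: is_iso_def iso_def)
  moreover have "subsemigroup G (range ?v)"
    unfolding subsemigroup_def
    using p q by (auto simp: word_value_append[OF p q, symmetric])
  ultimately show ?thesis by (simp add: bicyclic_subsemigroup_def)
qed

end

section \<open>Chains of finite sets as initial segments\<close>

text \<open>The sequence is built through its initial segments \<open>G n\<close>, each of which is kept comparable
  with every member of the chain. The next point is taken from the smallest member that properly
  contains \<open>G n\<close>. All other members with this property include the smallest one, so the new
  point lies in them too and \<open>G (n + 1)\<close> stays comparable with all of them.\<close>

lemma chain_of_initial_segments:
  assumes "infinite L"
    and sub: "\<And>F. F \<in> \<F> \<Longrightarrow> finite F \<and> F \<subseteq> L"
    and chain: "\<And>E F. E \<in> \<F> \<Longrightarrow> F \<in> \<F> \<Longrightarrow> E \<subseteq> F \<or> F \<subseteq> E"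
  obtains s :: "nat \<Rightarrow> 'a" where "inj s" "range s \<subseteq> L" "\<And>F. F \<in> \<F> \<Longrightarrow> \<exists>n. F = s ` {..<n}"
proof -
  let ?I = "\<lambda>n G. finite G \<and> card G = n \<and> G \<subseteq> L \<and> (\<forall>F\<in>\<F>. G \<subseteq> F \<or> F \<subseteq> G)"
  have base: "\<exists>G. ?I 0 G" by (intro exI[of _ "{}"]) simp
  have extend: "\<exists>H. ?I (Suc n) H \<and> (\<exists>x. x \<notin> G \<and> H = insert x G)" if G: "?I n G" for G n
  proof -
    have "\<exists>x\<in>L - G. \<forall>F\<in>\<F>. G \<subset> F \<longrightarrow> x \<in> F"
    proof (cases "\<exists>F\<in>\<F>. G \<subset> F")
      case True
      then obtain F where F: "F \<in> \<F>" "G \<subset> F"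
        and least: "\<And>E. E \<in> \<F> \<Longrightarrow> G \<subset> E \<Longrightarrow> card F \<le> card E"
        using exists_least_iff[of "\<lambda>k. \<exists>F\<in>\<F>. G \<subset> F \<and> card F = k"]
        by (metis linorder_not_less)
      have "F \<subseteq> E" if "E \<in> \<F>" "G \<subset> E" for E
        using chain[OF F(1) that(1)] least[OF that] sub[OF F(1)] card_seteq by blast
      then show ?thesis using F sub by blast
    next
      case False
      have "L - G \<noteq> {}"
        using \<open>infinite L\<close> G finite_subset by auto
      with False show ?thesis by blast
    qed
    then obtain x where x: "x \<in> L" "x \<notin> G" "\<And>F. F \<in> \<F> \<Longrightarrow> G \<subset> F \<Longrightarrow> x \<in> F"
      by blast
    have "?I (Suc n) (insert x G)"
      using G x by auto
    with x show ?thesis by blast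
  qed
  have "\<exists>G. \<forall>n. ?I n (G n) \<and> (\<exists>x. x \<notin> G n \<and> G (Suc n) = insert x (G n))"
    by (rule dependent_nat_choice) (fact base, fact extend)
  then obtain G where G: "\<And>n. ?I n (G n)"
    and step: "\<And>n. \<exists>x. x \<notin> G n \<and> G (Suc n) = insert x (G n)"
    by (elim exE) metis
  from step obtain s where s: "\<And>n. s n \<notin> G n" "\<And>n. G (Suc n) = insert (s n) (G n)"
    by metis
  have initial: "G n = s ` {..<n}" for n
  proof (induction n)
    case 0
    then show ?case using G[of 0] by auto
  qed (simp add: s lessThan_Suc)
  have "s i \<noteq> s j" if "i < j" for i j
  proof -
    have "s i \<in> G j" using that by (simp add: initial)
    with s(1)[of j] show ?thesis by auto
  qed
  then have "inj s"
    by (metis injI linorder_neqE_nat)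
  moreover have "range s \<subseteq> L"
    using G s(2) by blast
  moreover have "\<exists>n. F = s ` {..<n}" if "F \<in> \<F>" for F
  proof -
    \<comment> \<open>\<open>F\<close> and \<open>G (card F)\<close> are comparable finite sets of the same cardinality.\<close>
    have "G (card F) \<subseteq> F \<or> F \<subseteq> G (card F)" "card (G (card F)) = card F" "finite (G (card F))"
      using G[of "card F"] that by auto
    then have "F = G (card F)"
      using sub[OF that] card_subset_eq by metis
    then show ?thesis unfolding initial by (rule exI)
  qed
  ultimately show thesis by (rule that)
qed

section \<open>The shift along a sequence\<close>

lemma carrier_cofinite: "\<alpha> \<in> carrier (cofinite_partial_injections L) \<longleftrightarrow>
    dom \<alpha> \<subseteq> L \<and> ran \<alpha> \<subseteq> L \<and> inj_on \<alpha> (dom \<alpha>) \<and> finite (L - dom \<alpha>) \<and> finite (L - ran \<alpha>)"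
  by (simp add: cofinite_partial_injections_def)

lemma mult_cofinite: "\<alpha> \<otimes>\<^bsub>cofinite_partial_injections L\<^esub> \<beta> = \<beta> \<circ>\<^sub>m \<alpha>"
  by (simp add: cofinite_partial_injections_def)

lemma one_cofinite: "\<one>\<^bsub>cofinite_partial_injections L\<^esub> = Some |` L"
  by (simp add: cofinite_partial_injections_def)

definition shift :: "'a set \<Rightarrow> (nat \<Rightarrow> 'a) \<Rightarrow> 'a \<rightharpoonup> 'a" where
  "shift L s = (\<lambda>x. if x \<in> range s then Some (s (Suc (inv_into UNIV s x))) else (Some |` L) x)"

definition unshift :: "'a set \<Rightarrow> (nat \<Rightarrow> 'a) \<Rightarrow> 'a \<rightharpoonup> 'a" where
  "unshift L s = (\<lambda>x. if x = s 0 then None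
     else if x \<in> range s then Some (s (inv_into UNIV s x - 1)) else (Some |` L) x)"

context
  fixes L :: "'a set" and s :: "nat \<Rightarrow> 'a"
  assumes inj: "inj s" and range: "range s \<subseteq> L"
begin

lemma in_L: "s n \<in> L"
  using range by blast

lemma shift_seq: "shift L s (s n) = Some (s (Suc n))"
  using inj by (simp add: shift_def)

lemma unshift_seq: "unshift L s (s n) = (case n of 0 \<Rightarrow> None | Suc k \<Rightarrow> Some (s k))"
  using inj by (auto simp: unshift_def inj_eq split: nat.split)

lemma shift_other: "x \<notin> range s \<Longrightarrow> shift L s x = (Some |` L) x"
  by (simp add: shift_def)

lemma unshift_other: "x \<notin> range s \<Longrightarrow> unshift L s x = (Some |` L) x"
  by (auto simp: unshift_def)

text \<open>The two maps are inverse to each other as relations. Hence each is injective and the range of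
  each is the domain of the other.\<close>

lemma shift_eq_Some_iff: "shift L s x = Some y \<longleftrightarrow> unshift L s y = Some x"
proof (cases "x \<in> range s"; cases "y \<in> range s")
  assume "x \<in> range s" "y \<in> range s"
  then show ?thesis
    using inj by (auto simp: shift_seq unshift_seq inj_eq split: nat.splits)
next
  assume "x \<in> range s" "y \<notin> range s"
  then show ?thesis
    by (auto simp: shift_seq unshift_other restrict_map_def)
next
  assume "x \<notin> range s" "y \<in> range s"
  then show ?thesis
    by (auto simp: shift_other unshift_seq restrict_map_def split: nat.splits)
next
  assume "x \<notin> range s" "y \<notin> range s"
  then show ?thesis
    by (auto simp: shift_other unshift_other restrict_map_def)
qed

lemma dom_shift: "dom (shift L s) = L"
  using in_L by (auto simp: shift_def restrict_map_def split: if_splits)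

lemma dom_unshift: "dom (unshift L s) = L - {s 0}"
  using in_L by (auto simp: unshift_def restrict_map_def split: if_splits)

lemma ran_shift: "ran (shift L s) = L - {s 0}"
  using dom_unshift by (auto simp: ran_def shift_eq_Some_iff)

lemma ran_unshift: "ran (unshift L s) = L"
  using dom_shift by (auto simp: ran_def shift_eq_Some_iff[symmetric])

lemma shift_in_carrier: "shift L s \<in> carrier (cofinite_partial_injections L)"
proof -
  have "inj_on (shift L s) (dom (shift L s))"
    by (rule inj_onI) (metis domD option.inject shift_eq_Some_iff)
  moreover have "finite (L - (L - {s 0}))"
    by (rule finite_subset[of _ "{s 0}"]) auto
  ultimately show ?thesis
    unfolding carrier_cofinite by (auto simp: dom_shift ran_shift)
qed

lemma unshift_in_carrier: "unshift L s \<in> carrier (cofinite_partial_injections L)"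
proof -
  have "inj_on (unshift L s) (dom (unshift L s))"
    by (rule inj_onI) (metis domD option.inject shift_eq_Some_iff)
  moreover have "finite (L - (L - {s 0}))"
    by (rule finite_subset[of _ "{s 0}"]) auto
  ultimately show ?thesis
    unfolding carrier_cofinite by (auto simp: dom_unshift ran_unshift)
qed

lemma shift_mult_unshift:
  "shift L s \<otimes>\<^bsub>cofinite_partial_injections L\<^esub> unshift L s = \<one>\<^bsub>cofinite_partial_injections L\<^esub>"
proof -
  have "(unshift L s \<circ>\<^sub>m shift L s) x = (Some |` L) x" for x
  proof (cases "shift L s x")
    case None
    then show ?thesis using dom_shift by (auto simp: restrict_map_def)
  next
    case (Some y)
    then have "x \<in> L" using dom_shift by blast
    with Some show ?thesis by (simp add: shift_eq_Some_iff)
  qed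
  then show ?thesis by (simp add: mult_cofinite one_cofinite fun_eq_iff)
qed

text \<open>Conjugation by the shift moves the first \<open>n\<close> gaps one step up the sequence and opens a new
  gap at \<open>s 0\<close>.\<close>

lemma unshift_mult_identity_mult_shift:
  "shift L s \<circ>\<^sub>m (Some |` (L - s ` {..<n}) \<circ>\<^sub>m unshift L s) = Some |` (L - s ` {..<Suc n})"
proof
  fix x
  show "(shift L s \<circ>\<^sub>m (Some |` (L - s ` {..<n}) \<circ>\<^sub>m unshift L s)) x
      = (Some |` (L - s ` {..<Suc n})) x"
  proof (cases "x \<in> range s")
    case True
    then obtain k where "x = s k" by blast
    then show ?thesis
      using inj in_L
      by (cases k) (auto simp: map_comp_def unshift_seq shift_seq restrict_map_def inj_image_mem_iff)
  next
    case False
    then show ?thesis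
      by (auto simp: map_comp_def unshift_other shift_other restrict_map_def)
  qed
qed

lemma shift_power_idempotent:
  fixes n :: nat
  defines "M \<equiv> cofinite_partial_injections L"
  shows "unshift L s [^]\<^bsub>M\<^esub> n \<otimes>\<^bsub>M\<^esub> shift L s [^]\<^bsub>M\<^esub> n = Some |` (L - s ` {..<n})"
proof -
  interpret monoid M
    unfolding M_def by (rule monoid_cofinite_partial_injections)
  have p: "shift L s \<in> carrier M" and q: "unshift L s \<in> carrier M"
    unfolding M_def by (fact shift_in_carrier, fact unshift_in_carrier)
  show ?thesis
  proof (induction n)
    case 0
    have "unshift L s [^]\<^bsub>M\<^esub> (0::nat) \<otimes>\<^bsub>M\<^esub> shift L s [^]\<^bsub>M\<^esub> (0::nat) = \<one>\<^bsub>M\<^esub>"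
      by simp
    then show ?case by (simp only: M_def one_cofinite) simp
  next
    case (Suc n)
    have "unshift L s [^]\<^bsub>M\<^esub> Suc n \<otimes>\<^bsub>M\<^esub> shift L s [^]\<^bsub>M\<^esub> Suc n
        = unshift L s \<otimes>\<^bsub>M\<^esub> (unshift L s [^]\<^bsub>M\<^esub> n \<otimes>\<^bsub>M\<^esub> shift L s [^]\<^bsub>M\<^esub> n) \<otimes>\<^bsub>M\<^esub> shift L s"
      unfolding nat_pow_Suc2[OF q] using p q by (simp add: m_assoc)
    then show ?case
      using Suc by (simp add: M_def mult_cofinite unshift_mult_identity_mult_shift)
  qed
qed

text \<open>For \<open>n = 1\<close> this idempotent is \<open>qp\<close>, which is undefined at \<open>s 0\<close>; so \<open>qp \<noteq> 1\<close>.\<close>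

lemma shift_bicyclic_subsemigroup:
  obtains S where "bicyclic_subsemigroup (cofinite_partial_injections L) S"
    and "\<And>n. Some |` (L - s ` {..<n}) \<in> S"
proof -
  let ?M = "cofinite_partial_injections L" and ?p = "shift L s" and ?q = "unshift L s"
  interpret monoid ?M by (rule monoid_cofinite_partial_injections)
  have "unshift L s (s 0) = None" by (simp add: unshift_seq)
  then have "(?p \<circ>\<^sub>m ?q) (s 0) \<noteq> (Some |` L) (s 0)"
    using in_L by (simp add: map_comp_def)
  then have "?q \<otimes>\<^bsub>?M\<^esub> ?p \<noteq> \<one>\<^bsub>?M\<^esub>"
    unfolding mult_cofinite one_cofinite by metis
  then have "bicyclic_subsemigroup ?M (range (word_value ?M ?p ?q))"
    by (intro bicyclic_subsemigroup_of_one_sided_inverse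
        shift_in_carrier unshift_in_carrier shift_mult_unshift)
  moreover have "Some |` (L - s ` {..<n}) \<in> range (word_value ?M ?p ?q)" for n
    using word_value_normal_form[OF shift_in_carrier unshift_in_carrier, of n n]
    unfolding shift_power_idempotent by (metis rangeI)
  ultimately show thesis using that by blast
qed

end

section \<open>Chains of idempotents\<close>

text \<open>If \<open>e\<close> is defined at \<open>x\<close> with value \<open>y\<close>, then \<open>e\<close> takes the value \<open>y\<close> at \<open>y\<close> as well,
  and injectivity gives \<open>x = y\<close>.\<close>

lemma idempotent_is_partial_identity:
  assumes "e \<in> idempotents (cofinite_partial_injections L)"
  shows "e = Some |` dom e"
proof
  fix x
  have inj: "inj_on e (dom e)" and idem: "e \<circ>\<^sub>m e = e"
    using assms by (simp_all add: idempotents_def carrier_cofinite mult_cofinite)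
  show "e x = (Some |` dom e) x"
  proof (cases "e x")
    case None
    then show ?thesis by (auto simp: restrict_map_def)
  next
    case (Some y)
    then have "e y = Some y"
      using fun_cong[OF idem, of x] by simp
    then have "x = y"
      using Some inj by (metis domI inj_onD)
    with Some show ?thesis by (auto simp: restrict_map_def)
  qed
qed

lemma natural_order_imp_dom_subset:
  assumes "(e, f) \<in> natural_order (cofinite_partial_injections L)"
  shows "dom e \<subseteq> dom f"
proof
  have e: "e = Some |` dom e" and ef: "f \<circ>\<^sub>m e = e"
    using assms idempotent_is_partial_identity
    by (auto simp: natural_order_def mult_cofinite)
  fix x assume x: "x \<in> dom e"
  then have "e x = Some x" by (subst e) simp
  then show "x \<in> dom f"
    using fun_cong[OF ef, of x] by auto
qed

theorem proposition2:
  fixes L :: "'a set" and C :: "('a \<rightharpoonup> 'a) set"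
  assumes "infinite L"
    and "idempotent_chain (cofinite_partial_injections L) C"
  shows "\<exists>S. bicyclic_subsemigroup (cofinite_partial_injections L) S \<and> C \<subseteq> S"
proof -
  let ?M = "cofinite_partial_injections L"
  have idem: "e \<in> idempotents ?M" if "e \<in> C" for e
    using assms(2) that by (auto simp: idempotent_chain_def)
  then have cofinite: "dom e \<subseteq> L" "finite (L - dom e)" if "e \<in> C" for e
    using that by (auto simp: idempotents_def carrier_cofinite)
  have total: "total_on C (Restr (natural_order ?M) C)"
    using assms(2) by (simp add: idempotent_chain_def linear_order_on_def)
  have comparable: "dom e \<subseteq> dom f \<or> dom f \<subseteq> dom e" if "e \<in> C" "f \<in> C" for e f
  proof (cases "e = f")
    case False
    then have "(e, f) \<in> natural_order ?M \<or> (f, e) \<in> natural_order ?M"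
      using total that unfolding total_on_def by blast
    then show ?thesis using natural_order_imp_dom_subset by blast
  qed simp
  let ?\<F> = "(\<lambda>e. L - dom e) ` C"
  have finite: "finite F \<and> F \<subseteq> L" if "F \<in> ?\<F>" for F
    using that cofinite by blast
  have chain: "E \<subseteq> F \<or> F \<subseteq> E" if "E \<in> ?\<F>" "F \<in> ?\<F>" for E F
    using that comparable by blast
  obtain s :: "nat \<Rightarrow> 'a" where s: "inj s" "range s \<subseteq> L" "\<And>F. F \<in> ?\<F> \<Longrightarrow> \<exists>n. F = s ` {..<n}"
    using chain_of_initial_segments[OF assms(1) finite chain] by blast
  obtain S where S: "bicyclic_subsemigroup ?M S" "\<And>n. Some |` (L - s ` {..<n}) \<in> S"
    using shift_bicyclic_subsemigroup[OF s(1,2)] by blast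
  have "e \<in> S" if e: "e \<in> C" for e
  proof -
    obtain n where "L - dom e = s ` {..<n}"
      using s(3) e by blast
    then have "dom e = L - s ` {..<n}"
      using cofinite(1)[OF e] by blast
    then have "e = Some |` (L - s ` {..<n})"
      using idempotent_is_partial_identity[OF idem[OF e]] by simp
    then show ?thesis using S(2) by simp
  qed
  with S(1) show ?thesis by blast
qed

end
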